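(* Let $d \ge 2$ and let $\Omega = \mathbb{H}^d = \{x=(x_1,\dots,x_d)\in\mathbb{R}^d : x_1>0\}$, with boundary $\partial\Omega=\{x\in\mathbb{R}^d : x_1=0\}$. For a fixed but arbitrary constant $c>0$, let the locally bounded function $v_c:\overline{\Omega}\to\mathbb{R}$ be defined by $v_c(x)=0$ if $x\in\Omega$ and $v_c(x)=-c$ if $x\in\partial\Omega$. Then $v_c$ is a viscosity solution, in the sense of Barles--Souganidis, of the boundary value problem $H(D^2u)=0$ in $\Omega$, $u=0$ on $\partial\Omega$, where $H(A)=\sup_{B\in\mathcal{S}_1}(-B:A)$ (the Hamilton--Jacobi--Bellman form of the Monge--Ampère equation with vanishing source term $f=0$).
   Context: $\mathcal{S}_1$ is the set of symmetric positive semidefinite matrices in $\mathbb{R}^{d\times d}$ with trace equal to $1$, and $B:A=\sum_{i,j}B_{ij}A_{ij}$. For general $f\ge 0$ the Hamilton--Jacobi--Bellman operator is $H(A)=\sup_{B\in\mathcal{S}_1}(-B:A+f\sqrt{\det B})$; here $f=0$. For a locally bounded function $v:\overline{\Omega}\to\mathbb{R}$, its upper and lower semicontinuous envelopes on $\overline{\Omega}$ are $$v^*(x)=\sup_{\{y_n\}\subset\overline{\Omega},\ y_n\to x}\ \limsup_{n\to\infty}v(y_n),\qquad v_*(x)=\inf_{\{y_n\}\subset\overline{\Omega},\ y_n\to x}\ \liminf_{n\to\infty}v(y_n),$$ the supremum and infimum being over all sequences in $\overline\Omega$ converging to $x$. Define, for symmetric $A\in\mathbb{R}^{d\times d}$,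 $w\in\mathbb{R}$, $x\in\overline{\Omega}$, $$F_*(A,w,x)=\begin{cases}H(A), & x\in\Omega,\\ \min\{H(A),w\}, & x\in\partial\Omega,\end{cases}\qquad F^*(A,w,x)=\begin{cases}H(A), & x\in\Omega,\\ \max\{H(A),w\}, & x\in\partial\Omega.\end{cases}$$ In the sense of Barles--Souganidis: a locally bounded function $v$ is a viscosity subsolution of the boundary value problem if $F_*(D^2\phi(x),v^*(x),x)\le 0$ for all $\phi\in C^2(\overline{\Omega})$ such that $v^*-\phi$ has a local maximum (relative to $\overline\Omega$) at $x\in\overline{\Omega}$. It is a viscosity supersolution if $F^*(D^2\phi(x),v_*(x),x)\ge 0$ for all $\phi\in C^2(\overline{\Omega})$ such that $v_*-\phi$ has a local minimum (relative to $\overline\Omega$) at $x\in\overline{\Omega}$. It is a viscosity solution if it is both a viscosity subsolution and a viscosity supersolution. *)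

theory Defs
  imports "HOL-Analysis.Analysis"
begin

definition half_space :: "'n::finite \<Rightarrow> (real^'n) set" where
  "half_space k = {x. 0 < x $ k}"

lemma closure_half_space: "closure (half_space k) = {x. 0 \<le> x $ k}"
  using closure_halfspace_component_gt[of 0 k] by (simp add: half_space_def)

lemma frontier_half_space: "frontier (half_space k) = {x. x $ k = 0}"
proof -
  have "open (half_space k)"
    unfolding half_space_def by (intro open_Collect_less continuous_intros)
  then show ?thesis
    by (auto simp: frontier_def closure_half_space interior_open) (auto simp: half_space_def)
qed

definition locally_bounded_on :: "(real^'n) set \<Rightarrow> (real^'n \<Rightarrow> real) \<Rightarrow> bool" where
  "locally_bounded_on S v \<longleftrightarrow> (\<forall>x\<in>S. \<exists>e>0. bounded (v ` (ball x e \<inter> S)))"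

text \<open>The supremum and infimum are formed in the extended reals. For a locally bounded
  function they are finite at every point of the set, so that \<open>real_of_ereal\<close>, which
  sends infinite values to 0, loses nothing.\<close>

definition usc_envelope :: "(real^'n) set \<Rightarrow> (real^'n \<Rightarrow> real) \<Rightarrow> real^'n \<Rightarrow> real" where
  "usc_envelope S v x =
     real_of_ereal (SUP y\<in>{y. (\<forall>n. y n \<in> S) \<and> y \<longlonglongrightarrow> x}. limsup (\<lambda>n. ereal (v (y n))))"

definition lsc_envelope :: "(real^'n) set \<Rightarrow> (real^'n \<Rightarrow> real) \<Rightarrow> real^'n \<Rightarrow> real" where
  "lsc_envelope S v x =
     real_of_ereal (INF y\<in>{y. (\<forall>n. y n \<in> S) \<and> y \<longlonglongrightarrow> x}. liminf (\<lambda>n. ereal (v (y n))))"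

definition S1 :: "(real^'n^'n) set" where
  "S1 = {B. transpose B = B \<and> (\<forall>x. 0 \<le> x \<bullet> (B *v x)) \<and> trace B = 1}"

definition frobenius :: "real^'n^'n \<Rightarrow> real^'n^'n \<Rightarrow> real" where
  "frobenius B A = (\<Sum>i\<in>UNIV. \<Sum>j\<in>UNIV. B $ i $ j * A $ i $ j)"

definition HJB :: "real^'n^'n \<Rightarrow> real" where
  "HJB A = (SUP B\<in>S1. - frobenius B A)"

text \<open>The boundary case is the \<open>else\<close> branch: \<open>\<Omega>\<close> is open and \<open>x\<close> ranges over its closure.\<close>

definition F_lower :: "(real^'n) set \<Rightarrow> real^'n^'n \<Rightarrow> real \<Rightarrow> real^'n \<Rightarrow> real" where
  "F_lower \<Omega> A w x = (if x \<in> \<Omega> then HJB A else min (HJB A) w)"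

definition F_upper :: "(real^'n) set \<Rightarrow> real^'n^'n \<Rightarrow> real \<Rightarrow> real^'n \<Rightarrow> real" where
  "F_upper \<Omega> A w x = (if x \<in> \<Omega> then HJB A else max (HJB A) w)"

text \<open>\<open>C2_closure \<Omega> \<phi> D\<phi> D2\<phi>\<close> says that \<open>\<phi>\<close> is of class \<open>C\<^sup>2\<close> on the closure of the open set
  \<open>\<Omega>\<close>: it is \<open>C\<^sup>2\<close> in \<open>\<Omega>\<close>, and \<open>\<phi>\<close>, its gradient and its Hessian extend continuously to the
  closure. \<open>D\<phi>\<close> and \<open>D2\<phi>\<close> are these extensions. They are uniquely determined on
  the closure, and their values elsewhere are irrelevant.\<close>

definition C2_closure ::
  "(real^'n) set \<Rightarrow> (real^'n \<Rightarrow> real) \<Rightarrow> (real^'n \<Rightarrow> real^'n) \<Rightarrow> (real^'n \<Rightarrow> real^'n^'n) \<Rightarrow> bool" where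
  "C2_closure \<Omega> \<phi> D\<phi> D2\<phi> \<longleftrightarrow>
     (\<forall>x\<in>\<Omega>. (\<phi> has_derivative (\<lambda>h. D\<phi> x \<bullet> h)) (at x)) \<and>
     (\<forall>x\<in>\<Omega>. (D\<phi> has_derivative (\<lambda>h. D2\<phi> x *v h)) (at x)) \<and>
     continuous_on (closure \<Omega>) \<phi> \<and>
     continuous_on (closure \<Omega>) D\<phi> \<and>
     continuous_on (closure \<Omega>) D2\<phi>"

definition local_max_on :: "(real^'n) set \<Rightarrow> (real^'n \<Rightarrow> real) \<Rightarrow> real^'n \<Rightarrow> bool" where
  "local_max_on S u x \<longleftrightarrow> x \<in> S \<and> (\<exists>e>0. \<forall>y\<in>S \<inter> ball x e. u y \<le> u x)"

definition local_min_on :: "(real^'n) set \<Rightarrow> (real^'n \<Rightarrow> real) \<Rightarrow> real^'n \<Rightarrow> bool" where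
  "local_min_on S u x \<longleftrightarrow> x \<in> S \<and> (\<exists>e>0. \<forall>y\<in>S \<inter> ball x e. u x \<le> u y)"

definition viscosity_subsolution :: "(real^'n) set \<Rightarrow> (real^'n \<Rightarrow> real) \<Rightarrow> bool" where
  "viscosity_subsolution \<Omega> v \<longleftrightarrow>
     locally_bounded_on (closure \<Omega>) v \<and>
     (\<forall>\<phi> D\<phi> D2\<phi>. C2_closure \<Omega> \<phi> D\<phi> D2\<phi> \<longrightarrow>
       (\<forall>x\<in>closure \<Omega>.
          local_max_on (closure \<Omega>) (\<lambda>y. usc_envelope (closure \<Omega>) v y - \<phi> y) x \<longrightarrow>
          F_lower \<Omega> (D2\<phi> x) (usc_envelope (closure \<Omega>) v x) x \<le> 0))"

definition viscosity_supersolution :: "(real^'n) set \<Rightarrow> (real^'n \<Rightarrow> real) \<Rightarrow> bool" where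
  "viscosity_supersolution \<Omega> v \<longleftrightarrow>
     locally_bounded_on (closure \<Omega>) v \<and>
     (\<forall>\<phi> D\<phi> D2\<phi>. C2_closure \<Omega> \<phi> D\<phi> D2\<phi> \<longrightarrow>
       (\<forall>x\<in>closure \<Omega>.
          local_min_on (closure \<Omega>) (\<lambda>y. lsc_envelope (closure \<Omega>) v y - \<phi> y) x \<longrightarrow>
          F_upper \<Omega> (D2\<phi> x) (lsc_envelope (closure \<Omega>) v x) x \<ge> 0))"

definition viscosity_solution :: "(real^'n) set \<Rightarrow> (real^'n \<Rightarrow> real) \<Rightarrow> bool" where
  "viscosity_solution \<Omega> v \<longleftrightarrow> viscosity_subsolution \<Omega> v \<and> viscosity_supersolution \<Omega> v"

end

theory Submission
  imports Defs
begin

text \<open>Approaching a boundary point from the interior shows that the upper envelope of \<open>v\<close> is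
  identically \<open>0\<close> on the closed half space, whereas \<open>v\<close> is already lower semicontinuous, so its lower
  envelope is \<open>v\<close> itself.

  Subsolution. On the boundary the relaxed condition is satisfied by the boundary value \<open>0\<close>. In the
  interior a test function \<open>\<phi>\<close> touches the constant \<open>0\<close> from above, so its Hessian is positive
  semidefinite. Since a symmetric positive semidefinite \<open>B\<close> is a sum of matrices
  \<open>e \<otimes> e\<close>, each with \<open>(e \<otimes> e) : A = e \<bullet> A e\<close>, this gives \<open>B : D\<^sup>2\<phi> \<ge> 0\<close>, hence
  \<open>H(D\<^sup>2\<phi>) \<le> 0\<close> (\<open>psd_frobenius_nonneg\<close>, \<open>HJB_nonpos\<close>).

  Supersolution. The boundary value \<open>- c\<close> violates the boundary condition, so the equation itself must
  hold up to the boundary. It does because the operator is degenerate: a single direction \<open>e\<close> with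
  \<open>e \<bullet> D\<^sup>2\<phi> e \<le> 0\<close> already forces \<open>H(D\<^sup>2\<phi>) \<ge> 0\<close> (\<open>HJB_nonneg\<close>). In dimension at least two there
  is a coordinate direction parallel to the boundary. Along it \<open>v\<close> is constant, at interior
  and boundary points alike, so \<open>\<phi>\<close> has a maximum along that line and the second derivative there
  is nonpositive. The jump \<open>c\<close> across the boundary is invisible to such a direction.

  The test functions are \<open>C\<^sup>2\<close> only up to the boundary, in the sense that the derivatives extend
  continuously. The second derivative test on a line inside the boundary is therefore carried out on
  parallel segments in the interior, followed by a passage to the limit
  (\<open>quadratic_form_nonpos_at_directional_max\<close>).\<close>

section \<open>The operator on matrices with a sign condition\<close>

lemma frobenius_rank_one:
  "frobenius (\<chi> i j. e $ i * e $ j) A = e \<bullet> (A *v e)"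
  unfolding frobenius_def inner_vec_def matrix_vector_mult_def
  by (simp add: sum_distrib_left algebra_simps)

lemma rank_one_mult_vec:
  fixes e :: "real^'n"
  shows "(\<chi> i j. e $ i * e $ j) *v x = (e \<bullet> x) *\<^sub>R e"
  by (simp add: vec_eq_iff matrix_vector_mult_def inner_vec_def sum_distrib_right sum_distrib_left
      algebra_simps)

lemma rank_one_in_S1:
  fixes e :: "real^'n"
  assumes "norm e = 1"
  shows "(\<chi> i j. e $ i * e $ j) \<in> S1"
proof -
  have "trace (\<chi> i j. e $ i * e $ j) = e \<bullet> e"
    by (simp add: trace_def inner_vec_def)
  moreover have "0 \<le> x \<bullet> ((\<chi> i j. e $ i * e $ j) *v x)" for x
    by (simp add: rank_one_mult_vec inner_commute)
  ultimately show ?thesis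
    using assms by (simp add: S1_def transpose_def mult.commute norm_eq_1)
qed

text \<open>Instead of diagonalising \<open>B\<close>, the proof splits off one
  rank one term at a time as in the Cholesky decomposition: if \<open>B\<^sub>i\<^sub>i > 0\<close>, then subtracting
  \<open>e \<otimes> e\<close> with \<open>e = B e\<^sub>i / sqrt B\<^sub>i\<^sub>i\<close> leaves a positive semidefinite matrix (a Schur complement)
  with at least one more zero on the diagonal.\<close>

lemma psd_frobenius_nonneg:
  fixes A B :: "real^'n^'n"
  assumes "transpose B = B" and "\<And>x. 0 \<le> x \<bullet> (B *v x)" and A: "\<And>x. 0 \<le> x \<bullet> (A *v x)"
  shows "0 \<le> frobenius B A"
  using assms(1,2)
proof (induction "card {i. B $ i $ i \<noteq> 0}" arbitrary: B rule: less_induct)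
  case less
  have sym: "B $ i $ j = B $ j $ i" for i j
    using less.prems(1) by (metis transpose_def vec_lambda_beta)
  have axis_inner: "axis i 1 \<bullet> (B *v x) = (B *v x) $ i" for i x
    by (simp add: inner_axis')
  have dual: "x \<bullet> (B *v y) = (B *v x) \<bullet> y" for x y
    using less.prems(1) by (metis dot_lmul_matrix vector_transpose_matrix)
  have col: "(B *v axis i 1) $ j = B $ j $ i" for i j
    by (simp add: matrix_vector_mult_basis column_def)
  show ?case
  proof (cases "\<exists>i. B $ i $ i \<noteq> 0")
    case False
    \<comment> \<open>With a zero diagonal the form at \<open>e\<^sub>i + t e\<^sub>j\<close> is linear in \<open>t\<close>; nonnegativity kills its slope.\<close>
    have "B $ i $ j = 0" for i j
    proof -
      have "0 \<le> (axis i 1 + t *\<^sub>R axis j 1) \<bullet> (B *v (axis i 1 + t *\<^sub>R axis j 1))" for t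
        by (rule less.prems(2))
      then have "0 \<le> 2 * t * B $ i $ j" for t
        using False sym[of i j]
        by (simp add: matrix_vector_right_distrib matrix_vector_mult_scaleR inner_add_left
            inner_add_right axis_inner col)
      from this[of 1] this[of "-1"] show ?thesis by simp
    qed
    then show ?thesis by (simp add: frobenius_def)
  next
    case True
    then obtain i where i: "B $ i $ i \<noteq> 0" by blast
    have "0 \<le> B $ i $ i"
      using less.prems(2)[of "axis i 1"] by (simp add: axis_inner col)
    with i have pos: "0 < B $ i $ i" by simp
    define b where "b = B *v axis i 1"
    define e where "e = (1 / sqrt (B $ i $ i)) *\<^sub>R b"
    define C where "C = B - (\<chi> i j. e $ i * e $ j)"
    have bj: "b $ j = B $ j $ i" for j
      by (simp add: b_def col)
    have e2: "e $ j * e $ l = b $ j * b $ l / B $ i $ i" for j l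
      using pos by (simp add: e_def)
    have Cjl: "C $ j $ l = B $ j $ l - b $ j * b $ l / B $ i $ i" for j l
      by (simp add: C_def e2)
    have "transpose C = C"
      by (simp add: vec_eq_iff transpose_def Cjl sym mult.commute)
    moreover have Cpsd: "0 \<le> x \<bullet> (C *v x)" for x
    proof -
      \<comment> \<open>This \<open>t\<close> minimises the form of \<open>B\<close> on the line \<open>x - t e\<^sub>i\<close>; the minimum is the form of \<open>C\<close>.\<close>
      define t where "t = (b \<bullet> x) / B $ i $ i"
      have q: "axis i 1 \<bullet> (B *v x) = b \<bullet> x"
        by (simp add: b_def dual)
      have q': "x \<bullet> (B *v axis i 1) = b \<bullet> x"
        by (simp add: b_def inner_commute)
      have bb: "axis i 1 \<bullet> (B *v axis i 1) = B $ i $ i"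
        by (simp add: axis_inner col)
      have "0 \<le> (x - t *\<^sub>R axis i 1) \<bullet> (B *v (x - t *\<^sub>R axis i 1))"
        by (rule less.prems(2))
      also have "\<dots> = x \<bullet> (B *v x) - 2 * t * (b \<bullet> x) + t * t * B $ i $ i"
        by (simp add: matrix_vector_mult_diff_distrib matrix_vector_mult_scaleR inner_diff_left
            inner_diff_right q q' bb algebra_simps)
      also have "\<dots> = x \<bullet> (B *v x) - (b \<bullet> x) * (b \<bullet> x) / B $ i $ i"
        using pos by (simp add: t_def field_simps)
      also have "\<dots> = x \<bullet> (B *v x) - (e \<bullet> x) * (e \<bullet> x)"
        using pos by (simp add: e_def)
      also have "\<dots> = x \<bullet> (C *v x)"
        by (simp add: C_def matrix_vector_mult_diff_rdistrib rank_one_mult_vec inner_diff_right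
            inner_commute)
      finally show ?thesis .
    qed
    moreover have "card {j. C $ j $ j \<noteq> 0} < card {j. B $ j $ j \<noteq> 0}"
    proof (rule psubset_card_mono)
      have "C $ j $ j = 0" if "B $ j $ j = 0" for j
      proof -
        have "0 \<le> axis j 1 \<bullet> (C *v axis j 1)" by (rule Cpsd)
        then have "0 \<le> C $ j $ j"
          by (simp add: inner_axis' matrix_vector_mult_basis column_def)
        moreover have "C $ j $ j \<le> 0"
          using that pos by (simp add: Cjl)
        ultimately show ?thesis by simp
      qed
      moreover have "C $ i $ i = 0"
        using i by (simp add: Cjl bj)
      ultimately show "{j. C $ j $ j \<noteq> 0} \<subset> {j. B $ j $ j \<noteq> 0}"
        using i by blast
    qed simp
    ultimately have "0 \<le> frobenius C A"
      by (intro less.hyps)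
    moreover have "frobenius B A = frobenius C A + e \<bullet> (A *v e)"
      unfolding frobenius_rank_one[symmetric]
      by (simp add: frobenius_def C_def sum.distrib[symmetric] algebra_simps)
    ultimately show ?thesis
      using A[of e] by simp
  qed
qed

text \<open>The trace normalisation enters here: \<open>A - m I\<close> is positive semidefinite and
  \<open>B : I = trace B = 1\<close>.\<close>

lemma frobenius_ge_of_quadratic_form_ge:
  fixes A B :: "real^'n^'n"
  assumes "B \<in> S1" and A: "\<And>x. m * (x \<bullet> x) \<le> x \<bullet> (A *v x)"
  shows "m \<le> frobenius B A"
proof -
  have "0 \<le> x \<bullet> ((A - mat m) *v x)" for x
  proof -
    have "mat m *v x = m *\<^sub>R x"
      by (simp add: vec_eq_iff matrix_vector_mult_def mat_def if_distrib[of "\<lambda>a. a * _"] cong: if_cong)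
    then show ?thesis
      using A[of x] by (simp add: matrix_vector_mult_diff_rdistrib inner_diff_right)
  qed
  then have "0 \<le> frobenius B (A - mat m)"
    using assms(1) by (intro psd_frobenius_nonneg) (auto simp: S1_def)
  also have "frobenius B (A - mat m) = frobenius B A - m * trace B"
    by (simp add: frobenius_def trace_def mat_def right_diff_distrib sum_subtractf
        if_distrib[of "\<lambda>a. _ * a"] sum_distrib_left mult.commute cong: if_cong)
  finally show ?thesis
    using assms(1) by (simp add: S1_def)
qed

text \<open>Without this bound the real-valued supremum in \<open>HJB\<close> would not dominate its individual terms.
  The lower bound on the quadratic form of \<open>A\<close> is minus a bound on the operator norm.\<close>

lemma bdd_above_HJB:
  fixes A :: "real^'n^'n"
  shows "bdd_above ((\<lambda>B. - frobenius B A) ` S1)"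
proof -
  obtain K where K: "\<And>x. norm (A *v x) \<le> norm x * K"
    using bounded_linear.bounded[OF matrix_vector_mul_bounded_linear] by blast
  have "- K * (x \<bullet> x) \<le> x \<bullet> (A *v x)" for x
  proof -
    have "\<bar>x \<bullet> (A *v x)\<bar> \<le> norm x * norm (A *v x)"
      by (rule Cauchy_Schwarz_ineq2)
    also have "\<dots> \<le> norm x * (norm x * K)"
      by (intro mult_left_mono K) simp
    also have "\<dots> = K * (x \<bullet> x)"
      by (simp add: dot_square_norm power2_eq_square)
    finally show ?thesis by simp
  qed
  then have "- K \<le> frobenius B A" if "B \<in> S1" for B
    using frobenius_ge_of_quadratic_form_ge[OF that] by blast
  then show ?thesis
    by (intro bdd_aboveI2[where M = K]) force
qed

lemma HJB_nonpos:
  fixes A :: "real^'n^'n"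
  assumes "\<And>x. 0 \<le> x \<bullet> (A *v x)"
  shows "HJB A \<le> 0"
  unfolding HJB_def
proof (rule cSUP_least)
  show "(S1 :: (real^'n^'n) set) \<noteq> {}"
    using rank_one_in_S1[of "axis undefined 1"] by auto
  show "- frobenius B A \<le> 0" if "B \<in> S1" for B
    using frobenius_ge_of_quadratic_form_ge[OF that, of 0 A] assms by simp
qed

text \<open>The matrix \<open>e \<otimes> e\<close> is a competitor in the supremum.\<close>

lemma HJB_nonneg:
  fixes A :: "real^'n^'n"
  assumes "norm e = 1" and "e \<bullet> (A *v e) \<le> 0"
  shows "0 \<le> HJB A"
proof -
  have "- frobenius (\<chi> i j. e $ i * e $ j) A \<le> HJB A"
    unfolding HJB_def by (intro cSUP_upper rank_one_in_S1 bdd_above_HJB assms)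
  then show ?thesis
    using assms(2) by (simp add: frobenius_rank_one)
qed

section \<open>The second derivative test up to the boundary\<close>

text \<open>After subtracting \<open>m t\<^sup>2 / 2\<close>, the restriction of \<open>\<phi>\<close> to the segment is convex, and the
  estimate is midpoint convexity. Unlike a Taylor expansion, the conclusion involves only values of
  \<open>\<phi>\<close>, so it survives when the segment is moved to the boundary.\<close>

lemma second_difference_ge:
  fixes \<phi> :: "real^'n \<Rightarrow> real"
  assumes "0 \<le> r"
    and D: "\<And>t. \<bar>t\<bar> \<le> r \<Longrightarrow>
      (\<phi> has_derivative (\<lambda>h. D\<phi> (p + t *\<^sub>R e) \<bullet> h)) (at (p + t *\<^sub>R e))"
    and D2: "\<And>t. \<bar>t\<bar> \<le> r \<Longrightarrow>
      (D\<phi> has_derivative (\<lambda>h. D2\<phi> (p + t *\<^sub>R e) *v h)) (at (p + t *\<^sub>R e))"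
    and ge: "\<And>t. \<bar>t\<bar> \<le> r \<Longrightarrow> m \<le> e \<bullet> (D2\<phi> (p + t *\<^sub>R e) *v e)"
  shows "m * r\<^sup>2 \<le> \<phi> (p + r *\<^sub>R e) + \<phi> (p - r *\<^sub>R e) - 2 * \<phi> p"
proof -
  define g where "g = (\<lambda>t. \<phi> (p + t *\<^sub>R e) - m * t\<^sup>2 / 2)"
  have "convex_on {-r..r} g"
  proof (rule f''_ge0_imp_convex)
    fix t assume "t \<in> {-r..r}"
    then have t: "\<bar>t\<bar> \<le> r" by auto
    have line: "((\<lambda>t. p + t *\<^sub>R e) has_derivative (\<lambda>s. s *\<^sub>R e)) (at t)"
      by (auto intro!: derivative_eq_intros)
    have "((\<lambda>t. \<phi> (p + t *\<^sub>R e)) has_real_derivative D\<phi> (p + t *\<^sub>R e) \<bullet> e) (at t)"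
      using has_derivative_compose[OF line D[OF t]]
      by (simp add: has_field_derivative_def mult_commute_abs)
    then show "(g has_real_derivative D\<phi> (p + t *\<^sub>R e) \<bullet> e - m * t) (at t)"
      unfolding g_def by (auto intro!: derivative_eq_intros)
    have "((\<lambda>t. D\<phi> (p + t *\<^sub>R e) \<bullet> e) has_real_derivative e \<bullet> (D2\<phi> (p + t *\<^sub>R e) *v e)) (at t)"
      using has_derivative_inner_left[OF has_derivative_compose[OF line D2[OF t]], of e]
      by (simp add: has_field_derivative_def matrix_vector_mult_scaleR inner_commute
          mult_commute_abs)
    then show "((\<lambda>t. D\<phi> (p + t *\<^sub>R e) \<bullet> e - m * t) has_real_derivative
        e \<bullet> (D2\<phi> (p + t *\<^sub>R e) *v e) - m) (at t)"
      by (auto intro!: derivative_eq_intros)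
    show "0 \<le> e \<bullet> (D2\<phi> (p + t *\<^sub>R e) *v e) - m"
      using ge[OF t] by simp
  qed simp
  from convex_onD[OF this, of "1/2" "-r" r] show ?thesis
    using \<open>0 \<le> r\<close> by (simp add: g_def field_simps)
qed

text \<open>The point \<open>x\<close> and the whole segment may lie in the boundary, where \<open>\<phi>\<close> is not assumed
  differentiable. If the conclusion failed, then \<open>e \<bullet> D\<^sup>2\<phi> e > m > 0\<close> near \<open>x\<close>, by continuity up
  to the boundary. Translating by \<open>s e\<^sub>k\<close> moves the segment into the open half space, where
  \<open>second_difference_ge\<close> applies with a bound independent of \<open>s\<close>. The limit \<open>s \<rightarrow> 0\<close> gives a positive second
  difference at \<open>x\<close>, contradicting the maximum.\<close>

lemma quadratic_form_nonpos_at_directional_max: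
  fixes \<phi> :: "real^'n \<Rightarrow> real"
  assumes C2: "C2_closure (half_space k) \<phi> D\<phi> D2\<phi>"
    and "0 < r"
    and line: "\<And>t. \<bar>t\<bar> \<le> r \<Longrightarrow> x + t *\<^sub>R e \<in> closure (half_space k)"
    and max: "\<And>t. \<bar>t\<bar> \<le> r \<Longrightarrow> \<phi> (x + t *\<^sub>R e) \<le> \<phi> x"
  shows "e \<bullet> (D2\<phi> x *v e) \<le> 0"
proof (rule ccontr)
  assume pos: "\<not> e \<bullet> (D2\<phi> x *v e) \<le> 0"
  define m where "m = (e \<bullet> (D2\<phi> x *v e)) / 2"
  have m: "0 < m" "m < e \<bullet> (D2\<phi> x *v e)"
    using pos by (auto simp: m_def)
  have x: "x \<in> closure (half_space k)"
    using line[of 0] \<open>0 < r\<close> by simp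
  have "continuous_on (closure (half_space k)) (\<lambda>y. e \<bullet> (D2\<phi> y *v e))"
    using C2 unfolding C2_closure_def matrix_vector_mult_def
    by (intro continuous_intros) auto
  then have "((\<lambda>y. e \<bullet> (D2\<phi> y *v e)) \<longlongrightarrow> e \<bullet> (D2\<phi> x *v e)) (at x within closure (half_space k))"
    using x by (auto simp: continuous_on_def)
  then have "\<forall>\<^sub>F y in at x within closure (half_space k). m < e \<bullet> (D2\<phi> y *v e)"
    using m(2) by (rule order_tendstoD)
  then obtain \<eta> where "0 < \<eta>"
    and \<eta>: "\<And>y. y \<in> closure (half_space k) \<Longrightarrow> dist y x < \<eta> \<Longrightarrow> m < e \<bullet> (D2\<phi> y *v e)"
    using m(2) unfolding eventually_at by metis
  \<comment> \<open>Half of \<open>\<eta>\<close> is spent on the segment, half on the shift; the \<open>+ 1\<close> covers \<open>e = 0\<close>.\<close>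
  define t where "t = min r (\<eta> / (2 * (norm e + 1)))"
  have t: "0 < t" "t \<le> r" "t * norm e < \<eta> / 2"
  proof -
    show "0 < t" "t \<le> r"
      using \<open>0 < r\<close> \<open>0 < \<eta>\<close> by (auto simp: t_def add_nonneg_pos)
    have "t * norm e < t * (norm e + 1)" using \<open>0 < t\<close> by simp
    also have "\<dots> \<le> \<eta> / (2 * (norm e + 1)) * (norm e + 1)"
      by (intro mult_right_mono) (auto simp: t_def)
    also have "\<dots> = \<eta> / 2"
      using norm_ge_zero[of e] by (simp add: field_simps add_nonneg_eq_0_iff)
    finally show "t * norm e < \<eta> / 2" .
  qed
  let ?n = "axis k 1 :: real^'n"
  have shifted: "m * t\<^sup>2 \<le> \<phi> (x + t *\<^sub>R e + s *\<^sub>R ?n) + \<phi> (x - t *\<^sub>R e + s *\<^sub>R ?n) - 2 * \<phi> (x + s *\<^sub>R ?n)"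
    if s: "0 < s" "s < \<eta> / 2" for s
  proof -
    have in_half: "x + s *\<^sub>R ?n + u *\<^sub>R e \<in> half_space k" if "\<bar>u\<bar> \<le> t" for u
      using line[of u] that t s unfolding closure_half_space by (simp add: half_space_def)
    have near: "dist (x + s *\<^sub>R ?n + u *\<^sub>R e) x < \<eta>" if "\<bar>u\<bar> \<le> t" for u
    proof -
      have "dist (x + s *\<^sub>R ?n + u *\<^sub>R e) x = norm (s *\<^sub>R ?n + u *\<^sub>R e)"
        by (simp add: dist_norm algebra_simps)
      also have "\<dots> \<le> s + \<bar>u\<bar> * norm e"
        using norm_triangle_ineq[of "s *\<^sub>R ?n" "u *\<^sub>R e"] s by simp
      also have "\<dots> \<le> s + t * norm e"
        using that by (simp add: mult_right_mono)
      finally show ?thesis using s t by simp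
    qed
    have "m * t\<^sup>2 \<le> \<phi> (x + s *\<^sub>R ?n + t *\<^sub>R e) + \<phi> (x + s *\<^sub>R ?n - t *\<^sub>R e) - 2 * \<phi> (x + s *\<^sub>R ?n)"
    proof (rule second_difference_ge)
      fix u :: real assume u: "\<bar>u\<bar> \<le> t"
      let ?y = "x + s *\<^sub>R ?n + u *\<^sub>R e"
      show "(\<phi> has_derivative (\<lambda>h. D\<phi> ?y \<bullet> h)) (at ?y)"
        "(D\<phi> has_derivative (\<lambda>h. D2\<phi> ?y *v h)) (at ?y)"
        using C2 in_half[OF u] by (auto simp: C2_closure_def)
      show "m \<le> e \<bullet> (D2\<phi> ?y *v e)"
        using \<eta>[OF _ near[OF u]] in_half[OF u] closure_subset by force
    qed (use t in simp)
    then show ?thesis by (simp add: algebra_simps)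
  qed
  have lim: "((\<lambda>s. \<phi> (y + s *\<^sub>R ?n)) \<longlongrightarrow> \<phi> y) (at_right 0)" if y: "y \<in> closure (half_space k)" for y
  proof (rule continuous_on_tendsto_compose[where f = \<phi>])
    show "continuous_on (closure (half_space k)) \<phi>"
      using C2 by (simp add: C2_closure_def)
    have "((\<lambda>s. y + s *\<^sub>R ?n) \<longlongrightarrow> y + 0 *\<^sub>R ?n) (at_right 0)"
      by (intro tendsto_intros)
    then show "((\<lambda>s. y + s *\<^sub>R ?n) \<longlongrightarrow> y) (at_right 0)" by simp
    show "\<forall>\<^sub>F s in at_right 0. y + s *\<^sub>R ?n \<in> closure (half_space k)"
      unfolding eventually_at_right_field
      using y by (intro exI[of _ 1]) (auto simp: closure_half_space)
  qed (rule y)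
  have ends: "x + t *\<^sub>R e \<in> closure (half_space k)" "x - t *\<^sub>R e \<in> closure (half_space k)"
    using line[of t] line[of "-t"] t by auto
  have "m * t\<^sup>2 \<le> \<phi> (x + t *\<^sub>R e) + \<phi> (x - t *\<^sub>R e) - 2 * \<phi> x"
  proof (rule tendsto_lowerbound)
    show "((\<lambda>s. \<phi> (x + t *\<^sub>R e + s *\<^sub>R ?n) + \<phi> (x - t *\<^sub>R e + s *\<^sub>R ?n) - 2 * \<phi> (x + s *\<^sub>R ?n)) \<longlongrightarrow>
        \<phi> (x + t *\<^sub>R e) + \<phi> (x - t *\<^sub>R e) - 2 * \<phi> x) (at_right 0)"
      by (intro tendsto_intros lim ends x)
    show "\<forall>\<^sub>F s in at_right 0. m * t\<^sup>2 \<le>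
        \<phi> (x + t *\<^sub>R e + s *\<^sub>R ?n) + \<phi> (x - t *\<^sub>R e + s *\<^sub>R ?n) - 2 * \<phi> (x + s *\<^sub>R ?n)"
      unfolding eventually_at_right_field
      using \<open>0 < \<eta>\<close> shifted by (intro exI[of _ "\<eta> / 2"]) auto
  qed simp
  moreover have "\<phi> (x + t *\<^sub>R e) \<le> \<phi> x" "\<phi> (x - t *\<^sub>R e) \<le> \<phi> x"
    using max[of t] max[of "-t"] t by auto
  moreover have "0 < m * t\<^sup>2" using m t by simp
  ultimately show False by simp
qed

lemma uminus_matrix_mult_vec:
  fixes A :: "real^'n^'m"
  shows "- A *v x = - (A *v x)"
  by (simp add: vec_eq_iff matrix_vector_mult_def sum_negf)

lemma C2_closure_uminus:
  fixes \<phi> :: "real^'n \<Rightarrow> real"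
  assumes "C2_closure \<Omega> \<phi> D\<phi> D2\<phi>"
  shows "C2_closure \<Omega> (\<lambda>x. - \<phi> x) (\<lambda>x. - D\<phi> x) (\<lambda>x. - D2\<phi> x)"
proof -
  have minus: "((\<lambda>x. - \<phi> x) has_derivative (\<lambda>h. - D\<phi> x \<bullet> h)) (at x)"
    and "((\<lambda>x. - D\<phi> x) has_derivative (\<lambda>h. - D2\<phi> x *v h)) (at x)" if "x \<in> \<Omega>" for x
    using assms that has_derivative_minus[of \<phi>] has_derivative_minus[of D\<phi>]
    by (simp_all add: C2_closure_def uminus_matrix_mult_vec)
  then show ?thesis
    using assms unfolding C2_closure_def by (intro conjI ballI minus continuous_intros) auto
qed

lemma line_in_ball:
  fixes x e :: "real^'n"
  assumes "0 < \<epsilon>"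
  obtains r where "0 < r" and "\<And>t. \<bar>t\<bar> \<le> r \<Longrightarrow> x + t *\<^sub>R e \<in> ball x \<epsilon>"
proof
  have pos: "0 < norm e + 1" by (simp add: add_nonneg_pos)
  then show "0 < \<epsilon> / (norm e + 1)" using assms by simp
  fix t :: real assume "\<bar>t\<bar> \<le> \<epsilon> / (norm e + 1)"
  then have "\<bar>t\<bar> * (norm e + 1) \<le> \<epsilon>" using pos by (simp add: field_simps)
  then have "\<bar>t\<bar> * norm e < \<epsilon>"
    using assms by (cases "t = 0") (auto simp: algebra_simps)
  then show "x + t *\<^sub>R e \<in> ball x \<epsilon>" by (simp add: dist_norm)
qed

section \<open>Semicontinuous envelopes and the viscosity inequalities\<close>

lemma usc_envelope_eqI:
  assumes bound: "\<And>y. y \<in> S \<Longrightarrow> v y \<le> a"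
    and "\<And>n. z n \<in> S" "z \<longlonglongrightarrow> x" "\<And>n. v (z n) = a"
  shows "usc_envelope S v x = a"
proof -
  have "(SUP y\<in>{y. (\<forall>n. y n \<in> S) \<and> y \<longlonglongrightarrow> x}. limsup (\<lambda>n. ereal (v (y n)))) = ereal a"
  proof (rule antisym)
    show "(SUP y\<in>{y. (\<forall>n. y n \<in> S) \<and> y \<longlonglongrightarrow> x}. limsup (\<lambda>n. ereal (v (y n)))) \<le> ereal a"
      using bound by (auto intro!: SUP_least Limsup_bounded)
    show "ereal a \<le> (SUP y\<in>{y. (\<forall>n. y n \<in> S) \<and> y \<longlonglongrightarrow> x}. limsup (\<lambda>n. ereal (v (y n))))"
      using assms(2-4) by (intro SUP_upper2[of z]) (auto simp: Limsup_const)
  qed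
  then show ?thesis by (simp add: usc_envelope_def)
qed

lemma lsc_envelope_eq_self:
  assumes "x \<in> S" and "open U" "x \<in> U" and bound: "\<And>y. y \<in> S \<Longrightarrow> y \<in> U \<Longrightarrow> v x \<le> v y"
  shows "lsc_envelope S v x = v x"
proof -
  have "(INF y\<in>{y. (\<forall>n. y n \<in> S) \<and> y \<longlonglongrightarrow> x}. liminf (\<lambda>n. ereal (v (y n)))) = ereal (v x)"
  proof (rule antisym)
    show "(INF y\<in>{y. (\<forall>n. y n \<in> S) \<and> y \<longlonglongrightarrow> x}. liminf (\<lambda>n. ereal (v (y n)))) \<le> ereal (v x)"
      using assms(1) by (intro INF_lower2[of "\<lambda>_. x"]) (auto simp: Liminf_const)
    show "ereal (v x) \<le> (INF y\<in>{y. (\<forall>n. y n \<in> S) \<and> y \<longlonglongrightarrow> x}. liminf (\<lambda>n. ereal (v (y n))))"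
    proof (rule INF_greatest)
      fix y assume y: "y \<in> {y. (\<forall>n. y n \<in> S) \<and> y \<longlonglongrightarrow> x}"
      then have "\<forall>\<^sub>F n in sequentially. y n \<in> U"
        using assms(2,3) by (auto dest: topological_tendstoD)
      then show "ereal (v x) \<le> liminf (\<lambda>n. ereal (v (y n)))"
        using y bound by (intro Liminf_bounded) (auto elim!: eventually_mono)
    qed
  qed
  then show ?thesis by (simp add: lsc_envelope_def)
qed

theorem proposition2p1:
  fixes k :: "'n::finite" and c :: real and v :: "real^'n \<Rightarrow> real"
  assumes "CARD('n) \<ge> 2"
    and "c > 0"
    and "\<And>x. x \<in> half_space k \<Longrightarrow> v x = 0"
    and "\<And>x. x \<in> frontier (half_space k) \<Longrightarrow> v x = - c"
  shows "viscosity_solution (half_space k) v"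
proof -
  let ?\<Omega> = "half_space k"
  have v: "v x = (if 0 < x $ k then 0 else - c)" if "x \<in> closure ?\<Omega>" for x
    using that assms(3)[of x] assms(4)[of x]
    unfolding closure_half_space frontier_half_space by (auto simp: half_space_def)
  have open_half: "open ?\<Omega>"
    unfolding half_space_def by (intro open_Collect_less continuous_intros)
  have bounded: "locally_bounded_on (closure ?\<Omega>) v"
    unfolding locally_bounded_on_def
  proof (intro ballI exI conjI)
    fix x show "bounded (v ` (ball x 1 \<inter> closure ?\<Omega>))"
      by (rule bounded_subset[of "{0, - c}"]) (auto simp: v)
  qed simp
  have usc: "usc_envelope (closure ?\<Omega>) v x = 0" if x: "x \<in> closure ?\<Omega>" for x
  proof (rule usc_envelope_eqI)
    let ?z = "\<lambda>n. x + inverse (real (Suc n)) *\<^sub>R axis k 1"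
    have z: "?z n \<in> ?\<Omega>" for n
      using x unfolding closure_half_space by (simp add: half_space_def add_nonneg_pos)
    show "?z n \<in> closure ?\<Omega>" "v (?z n) = 0" for n
      using z[of n] closure_subset assms(3) by blast+
    have "?z \<longlonglongrightarrow> x + 0 *\<^sub>R axis k 1"
      by (intro tendsto_intros LIMSEQ_inverse_real_of_nat)
    then show "?z \<longlonglongrightarrow> x" by simp
    show "v y \<le> 0" if "y \<in> closure ?\<Omega>" for y
      using v[OF that] assms(2) by simp
  qed
  have lsc: "lsc_envelope (closure ?\<Omega>) v x = v x" if x: "x \<in> closure ?\<Omega>" for x
  proof (cases "x \<in> ?\<Omega>")
    case True
    then show ?thesis
      using assms(3) by (intro lsc_envelope_eq_self[OF x open_half]) simp_all
  next
    case False
    then show ?thesis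
      using assms(2) by (intro lsc_envelope_eq_self[OF x open_UNIV]) (auto simp: v[OF x] v half_space_def)
  qed
  have "viscosity_subsolution ?\<Omega> v"
    unfolding viscosity_subsolution_def
  proof (intro conjI bounded allI impI ballI)
    fix \<phi> D\<phi> D2\<phi> x
    assume C2: "C2_closure ?\<Omega> \<phi> D\<phi> D2\<phi>" and x: "x \<in> closure ?\<Omega>"
      and max: "local_max_on (closure ?\<Omega>) (\<lambda>y. usc_envelope (closure ?\<Omega>) v y - \<phi> y) x"
    show "F_lower ?\<Omega> (D2\<phi> x) (usc_envelope (closure ?\<Omega>) v x) x \<le> 0"
    proof (cases "x \<in> ?\<Omega>")
      \<comment> \<open>Here \<open>- \<phi>\<close> has a local maximum, so the directional test applies to it in every direction.\<close>
      case True
      obtain \<epsilon> where "0 < \<epsilon>" and \<epsilon>: "\<And>y. y \<in> closure ?\<Omega> \<Longrightarrow> y \<in> ball x \<epsilon> \<Longrightarrow> \<phi> x \<le> \<phi> y"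
        using max by (auto simp: local_max_on_def usc x)
      obtain \<delta> where "0 < \<delta>" and \<delta>: "ball x \<delta> \<subseteq> ?\<Omega>"
        using open_half True open_contains_ball by blast
      have "0 \<le> e \<bullet> (D2\<phi> x *v e)" for e
      proof -
        obtain r where "0 < r" and r: "\<And>t. \<bar>t\<bar> \<le> r \<Longrightarrow> x + t *\<^sub>R e \<in> ball x (min \<epsilon> \<delta>)"
          using line_in_ball[of "min \<epsilon> \<delta>"] \<open>0 < \<epsilon>\<close> \<open>0 < \<delta>\<close> by (metis min_less_iff_conj)
        have line: "x + t *\<^sub>R e \<in> closure ?\<Omega>" if "\<bar>t\<bar> \<le> r" for t
          using r[OF that] \<delta> closure_subset by fastforce
        have "e \<bullet> (- D2\<phi> x *v e) \<le> 0"
          using r \<epsilon> line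
          by (intro quadratic_form_nonpos_at_directional_max[OF C2_closure_uminus[OF C2] \<open>0 < r\<close>]) auto
        then show ?thesis by (simp add: uminus_matrix_mult_vec)
      qed
      then have "HJB (D2\<phi> x) \<le> 0"
        by (rule HJB_nonpos)
      then show ?thesis
        using True by (simp add: F_lower_def)
    next
      case False
      then show ?thesis by (simp add: F_lower_def usc x)
    qed
  qed
  moreover have "viscosity_supersolution ?\<Omega> v"
    unfolding viscosity_supersolution_def
  proof (intro conjI bounded allI impI ballI)
    fix \<phi> D\<phi> D2\<phi> x
    assume C2: "C2_closure ?\<Omega> \<phi> D\<phi> D2\<phi>" and x: "x \<in> closure ?\<Omega>"
      and min: "local_min_on (closure ?\<Omega>) (\<lambda>y. lsc_envelope (closure ?\<Omega>) v y - \<phi> y) x"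
    \<comment> \<open>A direction parallel to the boundary, which exists because the dimension is at least two.\<close>
    obtain j where "j \<noteq> k"
      using assms(1) by (metis card_2_iff' card_le_Suc0_iff_eq finite UNIV_I not_less_eq_eq numeral_2_eq_2)
    let ?e = "axis j 1 :: real^'n"
    have comp: "(x + t *\<^sub>R ?e) $ k = x $ k" for t
      using \<open>j \<noteq> k\<close> by (simp add: axis_def)
    have line: "x + t *\<^sub>R ?e \<in> closure ?\<Omega>" for t
      using x unfolding closure_half_space mem_Collect_eq comp .
    have level: "v (x + t *\<^sub>R ?e) = v x" for t
      by (simp only: v[OF x] v[OF line] comp)
    obtain \<epsilon> where "0 < \<epsilon>"
      and \<epsilon>: "\<And>y. y \<in> closure ?\<Omega> \<Longrightarrow> y \<in> ball x \<epsilon> \<Longrightarrow> v x - \<phi> x \<le> v y - \<phi> y"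
      using min by (auto simp: local_min_on_def lsc x)
    obtain r where "0 < r" and r: "\<And>t. \<bar>t\<bar> \<le> r \<Longrightarrow> x + t *\<^sub>R ?e \<in> ball x \<epsilon>"
      using line_in_ball[OF \<open>0 < \<epsilon>\<close>] by blast
    have "?e \<bullet> (D2\<phi> x *v ?e) \<le> 0"
    proof (rule quadratic_form_nonpos_at_directional_max[OF C2 \<open>0 < r\<close> line])
      show "\<phi> (x + t *\<^sub>R ?e) \<le> \<phi> x" if "\<bar>t\<bar> \<le> r" for t
        using \<epsilon>[OF line r[OF that]] level[of t] by simp
    qed
    then have "0 \<le> HJB (D2\<phi> x)"
      by (intro HJB_nonneg[of ?e]) auto
    then show "0 \<le> F_upper ?\<Omega> (D2\<phi> x) (lsc_envelope (closure ?\<Omega>) v x) x"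
      by (simp add: F_upper_def le_max_iff_disj)
  qed
  ultimately show ?thesis
    by (simp add: viscosity_solution_def)
qed

end
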